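(* Let $K$ be an algebraically closed field of characteristic $0$, $G$ a finite abelian group, and let $\Gamma\colon A=\bigoplus_{g\in G}A_g$ be a $G$-graded regular $K$-algebra with bicharacter $\beta$. Let $G_0(\beta)=\{g\in G\mid \beta(g,h)=1\text{ for every }h\in G\}$, and let $\Gamma_0$ be the (minimal regular) grading on $A$ by $H=G/G_0(\beta)$ which is the coarsening of $\Gamma$ realized by the canonical projection $\pi\colon G\to H$. Then $A$ satisfies the primeness property for graded central polynomials with respect to $\Gamma$ if and only if $A$ satisfies it with respect to $\Gamma_0$.
   Context: Algebras are associative. Abelian groups are written additively. A $G$-grading on $A$ is a decomposition $A=\bigoplus_{g\in G}A_g$ into subspaces with $A_gA_h\subseteq A_{g+h}$. It is regular if (i) for every $n\in\mathbb N$ and $(g_1,\dots,g_n)\in G^n$ there exist $a_i\in A_{g_i}$ with $a_1\cdots a_n\neq 0$; and (ii) for every $g,h\in G$ there is a scalar $\beta(g,h)\in K^*$, depending only on $g,h$, such that $a_ga_h=\beta(g,h)a_ha_g$ for all $a_g\in A_g$, $a_h\in A_h$. The function $\beta\colon G\times G\to K^*$ is the bicharacter of the grading. For an epimorphism $\alpha\colon G\to H$ of groups, the coarsening of $\Gamma$ realized by $\alpha$ is the $H$-grading $A=\bigoplus_{h\in H}A'_h$ with $A'_h=\bigoplus_{g\in\alpha^{-1}(h)}A_g$. $K\langle X_G\rangle$ is the free unitary associative $G$-graded algebra on countably infinite disjoint sets $X_g$ ($g\in G$) of variables of degree $g$, written $x_i^{(g)}$. Let $(A,\Gamma)$ be $G$-graded.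 A polynomial $f(x_1^{(g_1)},\dots,x_n^{(g_n)})\in K\langle X_G\rangle$ is a graded identity of $A$ if it vanishes under all substitutions $x_i^{(g_i)}\mapsto a_i\in A_{g_i}$; it is a graded central polynomial if all these values lie in the centre $Z(A)$; it is a proper graded central polynomial if moreover it is not a graded identity. $A$ satisfies the primeness property for graded central polynomials (with respect to $\Gamma$) if, whenever $f,g\in K\langle X_G\rangle$ are polynomials in disjoint sets of variables such that $fg$ is a proper graded central polynomial, both $f$ and $g$ are proper graded central polynomials. *)

theory Defs
  imports
    "HOL-Algebra.Coset"
    "HOL-Library.Poly_Mapping"
    "HOL-Computational_Algebra.Polynomial"
begin

locale assoc_algebra = vector_space scale
  for scale :: "'k::field \<Rightarrow> 'a::ring_1 \<Rightarrow> 'a" (infixr \<open>*s\<close> 75) +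
  assumes scale_mult_left: "(c *s x) * y = c *s (x * y)"
    and scale_mult_right: "x * (c *s y) = c *s (x * y)"

definition centre :: "'a::ring_1 set" where
  "centre = {z. \<forall>x. z * x = x * z}"

text \<open>
  Words over \<open>'v\<close>, with concatenation written additively, because \<^type>\<open>poly_mapping\<close>
  equips \<open>'m \<Rightarrow>\<^sub>0 'k\<close> with the product of the monoid algebra of \<open>'m\<close> when \<open>'m\<close> is of class
  \<^class>\<open>monoid_add\<close>. The addition of words is not commutative.
\<close>

datatype 'v free_monoid = Mon (letters: "'v list")

instantiation free_monoid :: (type) monoid_add
begin

definition zero_free_monoid :: "'a free_monoid" where
  "0 = Mon []"

definition plus_free_monoid :: "'a free_monoid \<Rightarrow> 'a free_monoid \<Rightarrow> 'a free_monoid" where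
  "v + w = Mon (letters v @ letters w)"

instance
  by standard (simp_all add: zero_free_monoid_def plus_free_monoid_def)

end

type_synonym ('v, 'k) free_algebra = "'v free_monoid \<Rightarrow>\<^sub>0 'k"

definition vars :: "('v, 'k::zero) free_algebra \<Rightarrow> 'v set" where
  "vars f = (\<Union>w\<in>Poly_Mapping.keys f. set (letters w))"

definition eval_poly ::
  "('k::field \<Rightarrow> 'a::ring_1 \<Rightarrow> 'a) \<Rightarrow> ('v \<Rightarrow> 'a) \<Rightarrow> ('v, 'k) free_algebra \<Rightarrow> 'a" where
  "eval_poly scale \<rho> f =
     (\<Sum>w\<in>Poly_Mapping.keys f. scale (Poly_Mapping.lookup f w) (prod_list (map \<rho> (letters w))))"

text \<open>
  A grading is given by its family of components \<open>A\<close>, of which only the values on \<open>carrier G\<close>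
  matter. The group \<open>G\<close> is written multiplicatively, following HOL-Algebra.
\<close>

definition grading ::
  "('k::field \<Rightarrow> 'a::ring_1 \<Rightarrow> 'a) \<Rightarrow> ('g, 'm) monoid_scheme \<Rightarrow> ('g \<Rightarrow> 'a set) \<Rightarrow> bool" where
  "grading scale G A \<longleftrightarrow>
     (\<forall>g\<in>carrier G. module.subspace scale (A g)) \<and>
     (\<forall>x. \<exists>!c. (\<forall>g\<in>carrier G. c g \<in> A g) \<and> (\<forall>g. g \<notin> carrier G \<longrightarrow> c g = 0) \<and>
               finite {g. c g \<noteq> 0} \<and> x = (\<Sum>g | c g \<noteq> 0. c g)) \<and>
     (\<forall>g\<in>carrier G. \<forall>h\<in>carrier G. \<forall>a\<in>A g. \<forall>b\<in>A h. a * b \<in> A (g \<otimes>\<^bsub>G\<^esub> h))"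

definition regular_grading ::
  "('k::field \<Rightarrow> 'a::ring_1 \<Rightarrow> 'a) \<Rightarrow> ('g, 'm) monoid_scheme \<Rightarrow> ('g \<Rightarrow> 'a set) \<Rightarrow>
   ('g \<Rightarrow> 'g \<Rightarrow> 'k) \<Rightarrow> bool" where
  "regular_grading scale G A \<beta> \<longleftrightarrow>
     grading scale G A \<and>
     (\<forall>gs. set gs \<subseteq> carrier G \<longrightarrow> (\<exists>as. list_all2 (\<lambda>a g. a \<in> A g) as gs \<and> prod_list as \<noteq> 0)) \<and>
     (\<forall>g\<in>carrier G. \<forall>h\<in>carrier G. \<beta> g h \<noteq> 0 \<and> (\<forall>a\<in>A g. \<forall>b\<in>A h. a * b = scale (\<beta> g h) (b * a)))"

definition radical :: "('g, 'm) monoid_scheme \<Rightarrow> ('g \<Rightarrow> 'g \<Rightarrow> 'k::field) \<Rightarrow> 'g set" where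
  "radical G \<beta> = {g \<in> carrier G. \<forall>h\<in>carrier G. \<beta> g h = 1}"

text \<open>
  The span below is the internal sum of the subspaces \<open>A g\<close> with \<open>\<alpha> g = h\<close>, which is direct
  whenever \<open>A\<close> is a grading.
\<close>

definition coarsening ::
  "('k::field \<Rightarrow> 'a::ring_1 \<Rightarrow> 'a) \<Rightarrow> ('g, 'm) monoid_scheme \<Rightarrow> ('g \<Rightarrow> 'a set) \<Rightarrow>
   ('g \<Rightarrow> 'h) \<Rightarrow> 'h \<Rightarrow> 'a set" where
  "coarsening scale G A \<alpha> h = module.span scale (\<Union>g\<in>{g \<in> carrier G. \<alpha> g = h}. A g)"

text \<open>The pair \<open>(i, g)\<close> is the \<open>i\<close>-th variable of degree \<open>g\<close>.\<close>

definition graded_polys :: "('g, 'm) monoid_scheme \<Rightarrow> (nat \<times> 'g, 'k::zero) free_algebra set" where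
  "graded_polys G = {f. vars f \<subseteq> UNIV \<times> carrier G}"

definition graded_substs ::
  "('g, 'm) monoid_scheme \<Rightarrow> ('g \<Rightarrow> 'a set) \<Rightarrow> (nat \<times> 'g \<Rightarrow> 'a) set" where
  "graded_substs G A = {\<rho>. \<forall>i. \<forall>g\<in>carrier G. \<rho> (i, g) \<in> A g}"

definition graded_identity ::
  "('k::field \<Rightarrow> 'a::ring_1 \<Rightarrow> 'a) \<Rightarrow> ('g, 'm) monoid_scheme \<Rightarrow> ('g \<Rightarrow> 'a set) \<Rightarrow>
   (nat \<times> 'g, 'k) free_algebra \<Rightarrow> bool" where
  "graded_identity scale G A f \<longleftrightarrow> (\<forall>\<rho>\<in>graded_substs G A. eval_poly scale \<rho> f = 0)"

definition graded_central ::
  "('k::field \<Rightarrow> 'a::ring_1 \<Rightarrow> 'a) \<Rightarrow> ('g, 'm) monoid_scheme \<Rightarrow> ('g \<Rightarrow> 'a set) \<Rightarrow>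
   (nat \<times> 'g, 'k) free_algebra \<Rightarrow> bool" where
  "graded_central scale G A f \<longleftrightarrow> (\<forall>\<rho>\<in>graded_substs G A. eval_poly scale \<rho> f \<in> centre)"

definition proper_graded_central ::
  "('k::field \<Rightarrow> 'a::ring_1 \<Rightarrow> 'a) \<Rightarrow> ('g, 'm) monoid_scheme \<Rightarrow> ('g \<Rightarrow> 'a set) \<Rightarrow>
   (nat \<times> 'g, 'k) free_algebra \<Rightarrow> bool" where
  "proper_graded_central scale G A f \<longleftrightarrow>
     graded_central scale G A f \<and> \<not> graded_identity scale G A f"

definition primeness_property ::
  "('k::field \<Rightarrow> 'a::ring_1 \<Rightarrow> 'a) \<Rightarrow> ('g, 'm) monoid_scheme \<Rightarrow> ('g \<Rightarrow> 'a set) \<Rightarrow> bool" where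
  "primeness_property scale G A \<longleftrightarrow>
     (\<forall>p\<in>graded_polys G. \<forall>q\<in>graded_polys G.
        vars p \<inter> vars q = {} \<longrightarrow> proper_graded_central scale G A (p * q) \<longrightarrow>
        proper_graded_central scale G A p \<and> proper_graded_central scale G A q)"

end

theory Submission
  imports Defs
begin

text \<open>
  Both primeness properties say that \<open>A\<close> is commutative, that is, that the radical of \<open>\<beta>\<close> is
  all of \<open>G\<close>; this is why they are equivalent.

  If \<open>A\<close> is commutative, every polynomial is central, so \<open>proper\<close> only means \<open>not an identity\<close>,
  and evaluation is multiplicative (\<open>primeness_if_commutative\<close>). This holds for any family of
  components.

  If some \<open>g\<close> is not in the radical, regularity provides an element of degree \<open>g\<close> that fails to
  commute with another homogeneous element, whereas a product of an element of degree \<open>g\<close> and one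
  of degree \<open>g\<inverse>\<close> has degree in the radical and is central. So the product of one variable
  of degree \<open>g\<close> and one of degree \<open>g\<inverse>\<close> violates primeness
  (\<open>not_primeness_if_central_product\<close>). Coarsening along the projection enlarges the components
  only by radical degrees, so that the same two variables, now with the cosets of \<open>g\<close> and
  \<open>g\<inverse>\<close> as degrees, still work. This uses that the radical is closed under products, which
  follows from \<open>\<beta>\<close> being multiplicative in its first argument (\<open>beta_mult_left\<close>).
\<close>

section \<open>Evaluation of polynomials\<close>

context assoc_algebra
begin

lemma eval_poly_superset:
  assumes "finite S" "Poly_Mapping.keys f \<subseteq> S"
  shows "eval_poly scale \<rho> f =
    (\<Sum>w\<in>S. Poly_Mapping.lookup f w *s prod_list (map \<rho> (letters w)))"
  unfolding eval_poly_def
  by (rule sum.mono_neutral_left) (use assms in \<open>auto simp: in_keys_iff\<close>)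

lemma eval_poly_add: "eval_poly scale \<rho> (p + q) = eval_poly scale \<rho> p + eval_poly scale \<rho> q"
proof -
  let ?S = "Poly_Mapping.keys p \<union> Poly_Mapping.keys q"
  have "Poly_Mapping.keys (p + q) \<subseteq> ?S"
    by (rule Poly_Mapping.keys_add)
  then show ?thesis
    by (simp add: eval_poly_superset[of ?S] lookup_add scale_left_distrib sum.distrib)
qed

lemma eval_poly_single:
  "eval_poly scale \<rho> (Poly_Mapping.single w c) = c *s prod_list (map \<rho> (letters w))"
  by (subst eval_poly_superset[of "{w}"]) (auto simp: split: if_splits)

lemma poly_mapping_single_induct [case_names zero add]:
  fixes f :: "'b \<Rightarrow>\<^sub>0 'c::monoid_add"
  assumes "P 0" and "\<And>f w c. P f \<Longrightarrow> P (f + Poly_Mapping.single w c)"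
  shows "P f"
proof (induction f rule: Poly_Mapping.update_induct)
  case (update f w c)
  have "Poly_Mapping.update w c f = f + Poly_Mapping.single w c"
    using update.hyps
    by (intro poly_mapping_eqI)
      (auto simp: lookup_update lookup_add lookup_single when_def in_keys_iff)
  then show ?case
    using assms(2) update.IH by simp
qed (rule assms(1))

lemma eval_poly_zero: "eval_poly scale \<rho> 0 = 0"
  by (simp add: eval_poly_def)

lemma eval_poly_mult: "eval_poly scale \<rho> (p * q) = eval_poly scale \<rho> p * eval_poly scale \<rho> q"
proof -
  have single: "eval_poly scale \<rho> (Poly_Mapping.single v c * q) =
      eval_poly scale \<rho> (Poly_Mapping.single v c) * eval_poly scale \<rho> q" for v c
    by (induction q rule: poly_mapping_single_induct)
      (simp_all add: distrib_left eval_poly_zero eval_poly_add mult_single eval_poly_single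
        plus_free_monoid_def scale_mult_left scale_mult_right mult.commute)
  show ?thesis
    by (induction p rule: poly_mapping_single_induct)
      (simp_all add: distrib_right eval_poly_zero eval_poly_add single)
qed

section \<open>Primeness and commutativity\<close>

lemma subspace_centre: "subspace centre"
  by (rule subspaceI)
    (auto simp: centre_def distrib_left distrib_right scale_mult_left scale_mult_right)

lemma primeness_if_commutative:
  assumes "(centre :: 'a set) = UNIV"
  shows "primeness_property scale H B"
  unfolding primeness_property_def proper_graded_central_def graded_central_def
    graded_identity_def assms
  by (auto simp: eval_poly_mult)

text \<open>
  With one variable of degree \<open>h\<close> and one of degree \<open>h'\<close>, the product of the two variables takes
  only central values, while the first variable alone takes the noncentral value \<open>a\<close>.
\<close>

lemma not_primeness_if_central_product:
  fixes H :: "('h, 'n) monoid_scheme" and B :: "'h \<Rightarrow> 'a set"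
  assumes h: "h \<in> carrier H" "h' \<in> carrier H"
    and zero: "\<And>k. k \<in> carrier H \<Longrightarrow> 0 \<in> B k"
    and ab: "a \<in> B h" "b \<in> B h'" "a * b \<noteq> 0"
    and a: "a \<notin> centre"
    and central: "\<And>x y. x \<in> B h \<Longrightarrow> y \<in> B h' \<Longrightarrow> x * y \<in> centre"
  shows "\<not> primeness_property scale H B"
proof
  assume prime: "primeness_property scale H B"
  define p :: "(nat \<times> 'h, 'k) free_algebra" where "p = Poly_Mapping.single (Mon [(0, h)]) 1"
  define q :: "(nat \<times> 'h, 'k) free_algebra" where "q = Poly_Mapping.single (Mon [(1, h')]) 1"
  define \<rho> where "\<rho> = (\<lambda>_. 0)((0 :: nat, h) := a, (1, h') := b)"
  have p: "eval_poly scale \<sigma> p = \<sigma> (0, h)" and q: "eval_poly scale \<sigma> q = \<sigma> (1, h')" for \<sigma>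
    by (simp_all add: p_def q_def eval_poly_single)
  have vars: "vars p = {(0, h)}" "vars q = {(1, h')}"
    by (simp_all add: p_def q_def vars_def)
  have \<rho>: "\<rho> \<in> graded_substs H B"
    using h zero ab by (auto simp: graded_substs_def \<rho>_def)
  have "graded_central scale H B (p * q)"
    using h central by (auto simp: graded_central_def graded_substs_def eval_poly_mult p q)
  moreover have "eval_poly scale \<rho> (p * q) \<noteq> 0"
    using ab by (simp add: eval_poly_mult p q \<rho>_def)
  ultimately have "proper_graded_central scale H B (p * q)"
    using \<rho> by (auto simp: proper_graded_central_def graded_identity_def)
  moreover have "p \<in> graded_polys H" "q \<in> graded_polys H" "vars p \<inter> vars q = {}"
    using h by (auto simp: graded_polys_def vars)
  ultimately have "graded_central scale H B p"
    using prime by (auto simp: primeness_property_def proper_graded_central_def)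
  then have "eval_poly scale \<rho> p \<in> centre"
    using \<rho> by (auto simp: graded_central_def)
  then show False
    using a by (simp add: p \<rho>_def)
qed

text \<open>
  The components of a coarsening are spans, so that statements about products of their elements
  reduce to products of homogeneous elements of the finer grading.
\<close>

lemma mult_span_in_subspace:
  assumes "subspace V" and prod: "\<And>x y. x \<in> S \<Longrightarrow> y \<in> T \<Longrightarrow> x * y \<in> V"
    and "x \<in> span S" "y \<in> span T"
  shows "x * y \<in> V"
proof -
  have *: "x * y \<in> V" if "x \<in> S" for x
    using \<open>y \<in> span T\<close>
  proof (induction rule: span_induct_alt)
    case base
    show ?case using \<open>subspace V\<close> by (simp add: subspace_0)
  next
    case (step c y z)
    then show ?case
      using prod[OF that] \<open>subspace V\<close>
      by (simp add: distrib_left scale_mult_right subspace_add subspace_scale)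
  qed
  show ?thesis
    using \<open>x \<in> span S\<close>
  proof (induction rule: span_induct_alt)
    case base
    show ?case using \<open>subspace V\<close> by (simp add: subspace_0)
  next
    case (step c x z)
    then show ?case
      using * \<open>subspace V\<close>
      by (simp add: distrib_right scale_mult_left subspace_add subspace_scale)
  qed
qed

end

section \<open>The bicharacter of a regular grading and its radical\<close>

locale regular_graded_algebra = assoc_algebra scale + comm_group G
  for scale :: "'k::field \<Rightarrow> 'a::ring_1 \<Rightarrow> 'a" (infixr \<open>*s\<close> 75)
    and G :: "('g, 'm) monoid_scheme" (structure)
    and A :: "'g \<Rightarrow> 'a set"
    and \<beta> :: "'g \<Rightarrow> 'g \<Rightarrow> 'k" +
  assumes regular: "regular_grading scale G A \<beta>"
begin

lemma subspace_component: "g \<in> carrier G \<Longrightarrow> subspace (A g)"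
  using regular unfolding regular_grading_def grading_def by blast

lemma mult_component:
  "g \<in> carrier G \<Longrightarrow> h \<in> carrier G \<Longrightarrow> a \<in> A g \<Longrightarrow> b \<in> A h \<Longrightarrow> a * b \<in> A (g \<otimes> h)"
  using regular unfolding regular_grading_def grading_def by blast

lemma beta_commute:
  "g \<in> carrier G \<Longrightarrow> h \<in> carrier G \<Longrightarrow> a \<in> A g \<Longrightarrow> b \<in> A h \<Longrightarrow> a * b = \<beta> g h *s (b * a)"
  using regular unfolding regular_grading_def by blast

lemma nonzero_product3:
  assumes "g \<in> carrier G" "h \<in> carrier G" "k \<in> carrier G"
  obtains a b c where "a \<in> A g" "b \<in> A h" "c \<in> A k" "a * b * c \<noteq> 0"
proof -
  have "set [g, h, k] \<subseteq> carrier G"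
    using assms by simp
  then obtain as where "list_all2 (\<lambda>a g. a \<in> A g) as [g, h, k]" "prod_list as \<noteq> 0"
    using regular unfolding regular_grading_def by blast
  then show thesis
    using that by (auto simp: list_all2_Cons2 mult.assoc)
qed

lemma beta_mult_left:
  assumes g: "g \<in> carrier G" and g': "g' \<in> carrier G" and h: "h \<in> carrier G"
  shows "\<beta> (g \<otimes> g') h = \<beta> g h * \<beta> g' h"
proof -
  obtain a a' b where a: "a \<in> A g" and a': "a' \<in> A g'" and b: "b \<in> A h"
    and nz: "a * a' * b \<noteq> 0"
    using nonzero_product3[OF g g' h] .
  have "a * a' * b = \<beta> (g \<otimes> g') h *s (b * (a * a'))"
    using beta_commute[OF _ h mult_component[OF g g' a a'] b] g g' by simp
  moreover have "a * a' * b = (\<beta> g h * \<beta> g' h) *s (b * (a * a'))"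
  proof -
    have "a * a' * b = a * (\<beta> g' h *s (b * a'))"
      using beta_commute[OF g' h a' b] by (simp add: mult.assoc)
    also have "\<dots> = \<beta> g' h *s ((a * b) * a')"
      by (simp add: scale_mult_right mult.assoc)
    also have "\<dots> = \<beta> g' h *s ((\<beta> g h *s (b * a)) * a')"
      using beta_commute[OF g h a b] by simp
    finally show ?thesis
      by (simp add: scale_mult_left mult.assoc mult.commute)
  qed
  ultimately show ?thesis
    using nz by (metis scale_cancel_right scale_zero_right)
qed

lemma radical_mult: "g \<in> radical G \<beta> \<Longrightarrow> g' \<in> radical G \<beta> \<Longrightarrow> g \<otimes> g' \<in> radical G \<beta>"
  by (auto simp: radical_def beta_mult_left)

lemma one_in_radical: "\<one> \<in> radical G \<beta>"
proof -
  have "\<beta> \<one> h = 1" if "h \<in> carrier G" for h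
  proof -
    have "\<beta> \<one> h = \<beta> \<one> h * \<beta> \<one> h"
      using beta_mult_left[of \<one> \<one> h] that by simp
    moreover have "\<beta> \<one> h \<noteq> 0"
      using regular that unfolding regular_grading_def by blast
    ultimately show ?thesis by simp
  qed
  then show ?thesis by (simp add: radical_def)
qed

lemma span_components: "span (\<Union>g\<in>carrier G. A g) = UNIV"
proof -
  have "x \<in> span (\<Union>g\<in>carrier G. A g)" for x
  proof -
    obtain c where c: "\<forall>g\<in>carrier G. c g \<in> A g" "\<forall>g. g \<notin> carrier G \<longrightarrow> c g = 0"
      and x: "x = (\<Sum>g | c g \<noteq> 0. c g)"
      using regular unfolding regular_grading_def grading_def by metis
    show ?thesis
      unfolding x using c by (intro span_sum span_base) blast
  qed
  then show ?thesis by blast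
qed

lemma component_subset_centre:
  assumes g: "g \<in> radical G \<beta>"
  shows "A g \<subseteq> centre"
proof
  fix a assume a: "a \<in> A g"
  have "subspace {x. a * x = x * a}"
    by (rule subspaceI)
      (auto simp: distrib_left distrib_right scale_mult_left scale_mult_right)
  moreover have "(\<Union>h\<in>carrier G. A h) \<subseteq> {x. a * x = x * a}"
  proof clarify
    fix h b assume "h \<in> carrier G" "b \<in> A h"
    then show "a * b = b * a"
      using g a beta_commute[of g h a b] by (simp add: radical_def)
  qed
  ultimately have "span (\<Union>h\<in>carrier G. A h) \<subseteq> {x. a * x = x * a}"
    by (intro span_minimal)
  then show "a \<in> centre"
    by (auto simp: span_components centre_def)
qed

lemma centre_eq_UNIV:
  assumes "radical G \<beta> = carrier G"
  shows "centre = (UNIV :: 'a set)"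
proof -
  have "(\<Union>g\<in>carrier G. A g) \<subseteq> centre"
    using component_subset_centre assms by blast
  then have "span (\<Union>g\<in>carrier G. A g) \<subseteq> centre"
    by (intro span_minimal subspace_centre)
  then show ?thesis
    by (simp add: span_components top.extremum_unique)
qed

text \<open>
  If \<open>\<beta> g h \<noteq> 1\<close>, an element \<open>a\<close> of degree \<open>g\<close> with \<open>a * b \<noteq> 0\<close> for some \<open>b\<close> of degree
  \<open>h\<close> is not central. Applying regularity to the two pairs of degrees separately would give
  two unrelated elements of degree \<open>g\<close>; a nonzero product of three factors gives one that serves
  both purposes, since the last two factors may be exchanged up to a scalar.
\<close>

lemma noncentral_with_nonzero_product:
  assumes g: "g \<in> carrier G" "g \<notin> radical G \<beta>" and g': "g' \<in> carrier G"
  obtains a a' where "a \<in> A g" "a' \<in> A g'" "a * a' \<noteq> 0" "a \<notin> centre"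
proof -
  obtain h where h: "h \<in> carrier G" "\<beta> g h \<noteq> 1"
    using g by (auto simp: radical_def)
  obtain a b a' where ab: "a \<in> A g" "b \<in> A h" "a' \<in> A g'" and nz: "a * b * a' \<noteq> 0"
    using nonzero_product3[OF g(1) h(1) g'] .
  have "a * b * a' = \<beta> h g' *s (a * a' * b)"
    using beta_commute[of h g' b a'] h g' ab by (simp add: mult.assoc scale_mult_right)
  then have "a * a' \<noteq> 0"
    using nz by auto
  moreover have "a \<notin> centre"
  proof
    assume "a \<in> centre"
    then have "1 *s (b * a) = \<beta> g h *s (b * a)"
      using beta_commute[of g h a b] g h ab by (simp add: centre_def)
    then have "b * a = 0"
      using h by (metis scale_cancel_right)
    then show False
      using nz \<open>a \<in> centre\<close> by (simp add: centre_def)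
  qed
  ultimately show thesis
    using that ab by blast
qed

section \<open>Primeness for the grading and for its coarsening\<close>

lemma primeness_iff_radical:
  "primeness_property scale G A \<longleftrightarrow> radical G \<beta> = carrier G"
proof
  assume prime: "primeness_property scale G A"
  show "radical G \<beta> = carrier G"
  proof (rule ccontr)
    assume "radical G \<beta> \<noteq> carrier G"
    then obtain g where g: "g \<in> carrier G" "g \<notin> radical G \<beta>"
      by (auto simp: radical_def)
    obtain a a' where a: "a \<in> A g" "a' \<in> A (inv g)" "a * a' \<noteq> 0" "a \<notin> centre"
      using noncentral_with_nonzero_product[OF g, of "inv g"] g by auto
    have central: "x * y \<in> centre" if "x \<in> A g" "y \<in> A (inv g)" for x y
      using mult_component[of g "inv g" x y] component_subset_centre[OF one_in_radical] g that
      by auto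
    show False
      using not_primeness_if_central_product[where H = G and B = A, OF _ _ _ a central] prime g
      by (simp add: subspace_component subspace_0)
  qed
qed (rule primeness_if_commutative[OF centre_eq_UNIV])

lemma coset_radical_eqE:
  assumes "g \<in> carrier G" "g' \<in> carrier G" "radical G \<beta> #> g' = radical G \<beta> #> g"
  obtains r where "r \<in> radical G \<beta>" "g' = r \<otimes> g"
proof -
  have "g' \<in> radical G \<beta> #> g'"
    unfolding r_coset_def using one_in_radical assms by force
  then show thesis
    using that assms by (auto simp: r_coset_def)
qed

lemma primeness_coarsening_iff_radical:
  "primeness_property scale (G Mod radical G \<beta>)
     (coarsening scale G A (\<lambda>g. radical G \<beta> #> g)) \<longleftrightarrow> radical G \<beta> = carrier G"
  (is "primeness_property scale ?H ?B \<longleftrightarrow> _")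
proof
  assume prime: "primeness_property scale ?H ?B"
  show "radical G \<beta> = carrier G"
  proof (rule ccontr)
    assume "radical G \<beta> \<noteq> carrier G"
    then obtain g where g: "g \<in> carrier G" "g \<notin> radical G \<beta>"
      by (auto simp: radical_def)
    let ?h = "radical G \<beta> #> g" and ?h' = "radical G \<beta> #> inv g"
    obtain a a' where a: "a \<in> A g" "a' \<in> A (inv g)" "a * a' \<noteq> 0" "a \<notin> centre"
      using noncentral_with_nonzero_product[OF g, of "inv g"] g by auto
    have aB: "a \<in> ?B ?h" "a' \<in> ?B ?h'"
      using a g by (auto simp: coarsening_def intro!: span_base)
    have H: "?h \<in> carrier ?H" "?h' \<in> carrier ?H"
      using g by (auto simp: FactGroup_def RCOSETS_def)
    have central: "x * y \<in> centre" if "x \<in> ?B ?h" "y \<in> ?B ?h'" for x y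
    proof (rule mult_span_in_subspace[OF subspace_centre])
      show "x \<in> span (\<Union>k\<in>{k \<in> carrier G. radical G \<beta> #> k = ?h}. A k)"
        "y \<in> span (\<Union>k\<in>{k \<in> carrier G. radical G \<beta> #> k = ?h'}. A k)"
        using that by (simp_all add: coarsening_def)
    next
      fix u v
      assume "u \<in> (\<Union>k\<in>{k \<in> carrier G. radical G \<beta> #> k = ?h}. A k)"
        and "v \<in> (\<Union>k\<in>{k \<in> carrier G. radical G \<beta> #> k = ?h'}. A k)"
      then obtain k k' where k: "k \<in> carrier G" "radical G \<beta> #> k = ?h" "u \<in> A k"
        and k': "k' \<in> carrier G" "radical G \<beta> #> k' = ?h'" "v \<in> A k'"
        by blast
      obtain r where r: "r \<in> radical G \<beta>" "k = r \<otimes> g"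
        using coset_radical_eqE[of g k] g k by auto
      obtain r' where r': "r' \<in> radical G \<beta>" "k' = r' \<otimes> inv g"
        using coset_radical_eqE[of "inv g" k'] g k' by auto
      have carr: "r \<in> carrier G" "r' \<in> carrier G"
        using r r' by (auto simp: radical_def)
      have "k \<otimes> k' = (r \<otimes> r') \<otimes> (g \<otimes> inv g)"
        using g carr unfolding r r' by (simp only: m_ac m_closed inv_closed)
      then have "k \<otimes> k' = r \<otimes> r'"
        using g carr by simp
      then have "k \<otimes> k' \<in> radical G \<beta>"
        using radical_mult r r' by simp
      then show "u * v \<in> centre"
        using mult_component[OF k(1) k'(1) k(3) k'(3)] component_subset_centre by blast
    qed
    show False
      using not_primeness_if_central_product[where H = ?H and B = ?B, OF H _ aB a(3,4) central] prime
      by (simp add: coarsening_def span_zero)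
  qed
qed (rule primeness_if_commutative[OF centre_eq_UNIV])

end

theorem proposition15:
  fixes scale :: "'k::{alg_closed_field, field_char_0} \<Rightarrow> 'a::ring_1 \<Rightarrow> 'a"
    and G :: "('g, 'm) monoid_scheme"
    and A :: "'g \<Rightarrow> 'a set"
    and \<beta> :: "'g \<Rightarrow> 'g \<Rightarrow> 'k"
  assumes "assoc_algebra scale"
    and "comm_group G" and "finite (carrier G)"
    and "regular_grading scale G A \<beta>"
  shows "primeness_property scale G A \<longleftrightarrow>
    primeness_property scale (G Mod radical G \<beta>)
      (coarsening scale G A (\<lambda>g. radical G \<beta> #>\<^bsub>G\<^esub> g))"
proof -
  interpret regular_graded_algebra scale G A \<beta>
    using assms by (simp add: regular_graded_algebra_def regular_graded_algebra_axioms_def)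
  show ?thesis
    by (simp only: primeness_iff_radical primeness_coarsening_iff_radical)
qed

end
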